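(* Let $A$ be an AL-monoid and let $\{A_i\}_{i\in I}$ be a family of AL-monoids. For each $i\in I$ let $\alpha_i : A\to A_i$ be a map, and let $\alpha : A\to \prod_{i\in I}A_i$ be the map defined by $\alpha(a)(i)=\alpha_i(a)$ for $a\in A$, $i\in I$. If each $\alpha_i$ is a homomorphism, then $\alpha$ is also a homomorphism, and $\ker\alpha=\bigcap_{i\in I}\ker(\alpha_i)$.
   Context: An AL-monoid (autometrized lattice ordered monoid) is an algebra $(A,+,\vee,\wedge,\ast,0)$ of arity $(2,2,2,2,0)$ such that: (1) $(A,+,\vee,\wedge,0)$ is a commutative lattice ordered monoid, i.e. $(A,+,0)$ is a commutative monoid, $(A,\vee,\wedge)$ is a lattice with induced order $\leq$, and $+$ distributes over $\vee$ and over $\wedge$; (2) $a\ast(a\wedge b)+b=a\vee b$ for all $a,b\in A$; (3) for each $a\in A$ the maps $x\mapsto a+x$, $x\mapsto a\vee x$, $x\mapsto a\wedge x$, $x\mapsto a\ast x$ are contractions with respect to $\ast$, where $f:A\to A$ is a contraction if $f(x)\ast f(y)\leq x\ast y$ for all $x,y\in A$; (4) $[a\ast(a\vee b)]\wedge[b\ast(a\vee b)]=0$ for all $a,b\in A$. A homomorphism of AL-monoids is a map preserving $+,\ast,\vee,\wedge$ and $0$; its kernel is the set of elements mapped to $0$. The direct product $\prod_{i\in I}A_i$ is the AL-monoid whose elements are the families $(a_i)_{i\in I}$ with $a_i\in A_i$, with $+$, $\ast$, the order (hence $\vee$, $\wedge$) and $0$ defined componentwise. *)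

theory Defs
  imports "HOL-Algebra.Group"
begin

record 'a al_struct = "'a partial_object" +
  al_add  :: "['a, 'a] \<Rightarrow> 'a" (infixl "\<oplus>\<index>" 65)
  al_join :: "['a, 'a] \<Rightarrow> 'a" (infixl "\<curlyvee>\<index>" 60)
  al_meet :: "['a, 'a] \<Rightarrow> 'a" (infixl "\<curlywedge>\<index>" 62)
  al_ast  :: "['a, 'a] \<Rightarrow> 'a" (infixl "\<star>\<index>" 70)
  al_zero :: 'a ("\<zero>\<index>")

definition al_le :: "('a, 'm) al_struct_scheme \<Rightarrow> 'a \<Rightarrow> 'a \<Rightarrow> bool" (infix "\<preceq>\<index>" 50)
  where "a \<preceq>\<^bsub>A\<^esub> b \<longleftrightarrow> a \<curlywedge>\<^bsub>A\<^esub> b = a"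

definition al_contraction :: "('a, 'm) al_struct_scheme \<Rightarrow> ('a \<Rightarrow> 'a) \<Rightarrow> bool"
  where "al_contraction A f \<longleftrightarrow>
    f \<in> carrier A \<rightarrow> carrier A \<and>
    (\<forall>x\<in>carrier A. \<forall>y\<in>carrier A. f x \<star>\<^bsub>A\<^esub> f y \<preceq>\<^bsub>A\<^esub> x \<star>\<^bsub>A\<^esub> y)"

locale al_monoid =
  fixes A :: "('a, 'm) al_struct_scheme" (structure)
  assumes add_comm_monoid:
      "comm_monoid \<lparr>carrier = carrier A, monoid.mult = (\<oplus>), one = \<zero>\<rparr>"
    and join_closed: "\<lbrakk>a \<in> carrier A; b \<in> carrier A\<rbrakk> \<Longrightarrow> a \<curlyvee> b \<in> carrier A"
    and meet_closed: "\<lbrakk>a \<in> carrier A; b \<in> carrier A\<rbrakk> \<Longrightarrow> a \<curlywedge> b \<in> carrier A"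
    and ast_closed: "\<lbrakk>a \<in> carrier A; b \<in> carrier A\<rbrakk> \<Longrightarrow> a \<star> b \<in> carrier A"
    and join_assoc:
      "\<lbrakk>a \<in> carrier A; b \<in> carrier A; c \<in> carrier A\<rbrakk> \<Longrightarrow> (a \<curlyvee> b) \<curlyvee> c = a \<curlyvee> (b \<curlyvee> c)"
    and meet_assoc:
      "\<lbrakk>a \<in> carrier A; b \<in> carrier A; c \<in> carrier A\<rbrakk> \<Longrightarrow> (a \<curlywedge> b) \<curlywedge> c = a \<curlywedge> (b \<curlywedge> c)"
    and join_comm: "\<lbrakk>a \<in> carrier A; b \<in> carrier A\<rbrakk> \<Longrightarrow> a \<curlyvee> b = b \<curlyvee> a"
    and meet_comm: "\<lbrakk>a \<in> carrier A; b \<in> carrier A\<rbrakk> \<Longrightarrow> a \<curlywedge> b = b \<curlywedge> a"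
    and join_absorb: "\<lbrakk>a \<in> carrier A; b \<in> carrier A\<rbrakk> \<Longrightarrow> a \<curlyvee> (a \<curlywedge> b) = a"
    and meet_absorb: "\<lbrakk>a \<in> carrier A; b \<in> carrier A\<rbrakk> \<Longrightarrow> a \<curlywedge> (a \<curlyvee> b) = a"
    and add_join_distrib:
      "\<lbrakk>a \<in> carrier A; b \<in> carrier A; c \<in> carrier A\<rbrakk> \<Longrightarrow> a \<oplus> (b \<curlyvee> c) = (a \<oplus> b) \<curlyvee> (a \<oplus> c)"
    and add_meet_distrib:
      "\<lbrakk>a \<in> carrier A; b \<in> carrier A; c \<in> carrier A\<rbrakk> \<Longrightarrow> a \<oplus> (b \<curlywedge> c) = (a \<oplus> b) \<curlywedge> (a \<oplus> c)"
    and ast_meet_add: "\<lbrakk>a \<in> carrier A; b \<in> carrier A\<rbrakk> \<Longrightarrow> (a \<star> (a \<curlywedge> b)) \<oplus> b = a \<curlyvee> b"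
    and contraction_add: "a \<in> carrier A \<Longrightarrow> al_contraction A (\<lambda>x. a \<oplus> x)"
    and contraction_join: "a \<in> carrier A \<Longrightarrow> al_contraction A (\<lambda>x. a \<curlyvee> x)"
    and contraction_meet: "a \<in> carrier A \<Longrightarrow> al_contraction A (\<lambda>x. a \<curlywedge> x)"
    and contraction_ast: "a \<in> carrier A \<Longrightarrow> al_contraction A (\<lambda>x. a \<star> x)"
    and ast_join_disjoint:
      "\<lbrakk>a \<in> carrier A; b \<in> carrier A\<rbrakk> \<Longrightarrow> (a \<star> (a \<curlyvee> b)) \<curlywedge> (b \<star> (a \<curlyvee> b)) = \<zero>"

definition al_hom :: "('a, 'm) al_struct_scheme \<Rightarrow> ('b, 'n) al_struct_scheme \<Rightarrow> ('a \<Rightarrow> 'b) set"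
  where "al_hom A B = {f. f \<in> carrier A \<rightarrow> carrier B \<and>
    (\<forall>x\<in>carrier A. \<forall>y\<in>carrier A.
      f (x \<oplus>\<^bsub>A\<^esub> y) = f x \<oplus>\<^bsub>B\<^esub> f y \<and>
      f (x \<star>\<^bsub>A\<^esub> y) = f x \<star>\<^bsub>B\<^esub> f y \<and>
      f (x \<curlyvee>\<^bsub>A\<^esub> y) = f x \<curlyvee>\<^bsub>B\<^esub> f y \<and>
      f (x \<curlywedge>\<^bsub>A\<^esub> y) = f x \<curlywedge>\<^bsub>B\<^esub> f y) \<and>
    f \<zero>\<^bsub>A\<^esub> = \<zero>\<^bsub>B\<^esub>}"

definition al_kernel ::
    "('a, 'm) al_struct_scheme \<Rightarrow> ('b, 'n) al_struct_scheme \<Rightarrow> ('a \<Rightarrow> 'b) \<Rightarrow> 'a set"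
  where "al_kernel A B f = {x \<in> carrier A. f x = \<zero>\<^bsub>B\<^esub>}"

text \<open>The families are extensional (\<open>undefined\<close> outside \<open>I\<close>), so that two of them are
  equal as soon as their components over \<open>I\<close> agree. The factors share the type \<open>'b\<close> but may
  have different carriers.\<close>

definition al_prod :: "'i set \<Rightarrow> ('i \<Rightarrow> ('b, 'n) al_struct_scheme) \<Rightarrow> ('i \<Rightarrow> 'b) al_struct"
  where "al_prod I B = \<lparr>
    carrier = (\<Pi>\<^sub>E i\<in>I. carrier (B i)),
    al_add  = (\<lambda>x y. \<lambda>i\<in>I. x i \<oplus>\<^bsub>B i\<^esub> y i),
    al_join = (\<lambda>x y. \<lambda>i\<in>I. x i \<curlyvee>\<^bsub>B i\<^esub> y i),
    al_meet = (\<lambda>x y. \<lambda>i\<in>I. x i \<curlywedge>\<^bsub>B i\<^esub> y i),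
    al_ast  = (\<lambda>x y. \<lambda>i\<in>I. x i \<star>\<^bsub>B i\<^esub> y i),
    al_zero = (\<lambda>i\<in>I. \<zero>\<^bsub>B i\<^esub>)\<rparr>"

lemma al_prod_le_iff:
  assumes "x \<in> carrier (al_prod I B)"
  shows "x \<preceq>\<^bsub>al_prod I B\<^esub> y \<longleftrightarrow> (\<forall>i\<in>I. x i \<preceq>\<^bsub>B i\<^esub> y i)"
  using assms unfolding al_le_def al_prod_def
  by (auto simp: fun_eq_iff restrict_def PiE_def extensional_def)

context al_monoid
begin

lemma add_closed: "\<lbrakk>a \<in> carrier A; b \<in> carrier A\<rbrakk> \<Longrightarrow> a \<oplus> b \<in> carrier A"
  using monoid.m_closed[OF comm_monoid.axioms(1)[OF add_comm_monoid]] by simp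

lemma zero_closed: "\<zero> \<in> carrier A"
  using monoid.one_closed[OF comm_monoid.axioms(1)[OF add_comm_monoid]] by simp

lemma add_assoc:
  "\<lbrakk>a \<in> carrier A; b \<in> carrier A; c \<in> carrier A\<rbrakk> \<Longrightarrow> (a \<oplus> b) \<oplus> c = a \<oplus> (b \<oplus> c)"
  using monoid.m_assoc[OF comm_monoid.axioms(1)[OF add_comm_monoid]] by simp

lemma add_comm: "\<lbrakk>a \<in> carrier A; b \<in> carrier A\<rbrakk> \<Longrightarrow> a \<oplus> b = b \<oplus> a"
  using comm_monoid.m_comm[OF add_comm_monoid] by simp

lemma add_zero: "a \<in> carrier A \<Longrightarrow> \<zero> \<oplus> a = a"
  using monoid.l_one[OF comm_monoid.axioms(1)[OF add_comm_monoid]] by simp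

end

theorem al_monoid_prod:
  assumes B: "\<And>i. i \<in> I \<Longrightarrow> al_monoid (B i)"
  shows "al_monoid (al_prod I B)"
proof -
  let ?P = "al_prod I B"
  have car: "carrier ?P = (\<Pi>\<^sub>E i\<in>I. carrier (B i))" by (simp add: al_prod_def)
  have mem: "x i \<in> carrier (B i)" if "x \<in> carrier ?P" "i \<in> I" for x i
    using that by (auto simp: al_prod_def)
  have ext: "x = y" if "x \<in> carrier ?P" "y \<in> carrier ?P" "\<And>i. i \<in> I \<Longrightarrow> x i = y i" for x y
    using that unfolding car by (rule PiE_ext)
  have ops [simp]:
    "(x \<oplus>\<^bsub>?P\<^esub> y) i = x i \<oplus>\<^bsub>B i\<^esub> y i" "(x \<curlyvee>\<^bsub>?P\<^esub> y) i = x i \<curlyvee>\<^bsub>B i\<^esub> y i"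
    "(x \<curlywedge>\<^bsub>?P\<^esub> y) i = x i \<curlywedge>\<^bsub>B i\<^esub> y i" "(x \<star>\<^bsub>?P\<^esub> y) i = x i \<star>\<^bsub>B i\<^esub> y i"
    "\<zero>\<^bsub>?P\<^esub> i = \<zero>\<^bsub>B i\<^esub>" if "i \<in> I" for x y i
    using that by (simp_all add: al_prod_def)
  have cl [simp]: "x \<oplus>\<^bsub>?P\<^esub> y \<in> carrier ?P" "x \<curlyvee>\<^bsub>?P\<^esub> y \<in> carrier ?P"
    "x \<curlywedge>\<^bsub>?P\<^esub> y \<in> carrier ?P" "x \<star>\<^bsub>?P\<^esub> y \<in> carrier ?P"
    if "x \<in> carrier ?P" "y \<in> carrier ?P" for x y
    using that B mem by (auto simp: al_prod_def PiE_iff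
      intro!: al_monoid.add_closed al_monoid.join_closed al_monoid.meet_closed al_monoid.ast_closed)
  have z [simp]: "\<zero>\<^bsub>?P\<^esub> \<in> carrier ?P"
    using B by (auto simp: al_prod_def intro!: al_monoid.zero_closed)
  have con: "al_contraction ?P (\<lambda>x. g a x)"
    if "a \<in> carrier ?P" "\<And>x. x \<in> carrier ?P \<Longrightarrow> g a x \<in> carrier ?P"
      "\<And>x i. i \<in> I \<Longrightarrow> g a x i = h i (a i) (x i)"
      "\<And>i. i \<in> I \<Longrightarrow> al_contraction (B i) (h i (a i))" for a g h
    using that mem by (auto simp: al_contraction_def al_prod_le_iff)
  note M = al_monoid.join_assoc al_monoid.meet_assoc al_monoid.join_absorb al_monoid.meet_absorb
    al_monoid.add_join_distrib al_monoid.add_meet_distrib al_monoid.ast_meet_add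
    al_monoid.ast_join_disjoint al_monoid.add_assoc al_monoid.add_zero
  have comm: "x i \<oplus>\<^bsub>B i\<^esub> y i = y i \<oplus>\<^bsub>B i\<^esub> x i" "x i \<curlyvee>\<^bsub>B i\<^esub> y i = y i \<curlyvee>\<^bsub>B i\<^esub> x i"
    "x i \<curlywedge>\<^bsub>B i\<^esub> y i = y i \<curlywedge>\<^bsub>B i\<^esub> x i"
    if "x \<in> carrier ?P" "y \<in> carrier ?P" "i \<in> I" for x y i
    using that mem B al_monoid.add_comm al_monoid.join_comm al_monoid.meet_comm by metis+
  show ?thesis
  proof (rule al_monoid.intro)
    fix a assume a: "a \<in> carrier ?P"
    show "al_contraction ?P (\<lambda>x. a \<oplus>\<^bsub>?P\<^esub> x)"
      by (rule con[where h = "\<lambda>i. al_add (B i)"])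
        (use a mem B in \<open>auto intro: al_monoid.contraction_add\<close>)
    show "al_contraction ?P (\<lambda>x. a \<curlyvee>\<^bsub>?P\<^esub> x)"
      by (rule con[where h = "\<lambda>i. al_join (B i)"])
        (use a mem B in \<open>auto intro: al_monoid.contraction_join\<close>)
    show "al_contraction ?P (\<lambda>x. a \<curlywedge>\<^bsub>?P\<^esub> x)"
      by (rule con[where h = "\<lambda>i. al_meet (B i)"])
        (use a mem B in \<open>auto intro: al_monoid.contraction_meet\<close>)
    show "al_contraction ?P (\<lambda>x. a \<star>\<^bsub>?P\<^esub> x)"
      by (rule con[where h = "\<lambda>i. al_ast (B i)"])
        (use a mem B in \<open>auto intro: al_monoid.contraction_ast\<close>)
  next
    show "comm_monoid \<lparr>carrier = carrier ?P, monoid.mult = al_add ?P, one = \<zero>\<^bsub>?P\<^esub>\<rparr>"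
      by (rule comm_monoidI)
        (auto intro!: ext simp: mem B al_monoid.add_assoc al_monoid.add_zero comm)
  qed (auto intro!: ext simp: mem B M comm)
qed

end

theory Submission imports Defs begin

text \<open>Every operation of the product acts componentwise, so each homomorphism law for the
  combined map is, at index \<open>i\<close>, the same law for \<open>\<alpha> i\<close>;
  restricting families to \<open>I\<close> makes them extensional, so agreement on \<open>I\<close>
  is equality. Likewise a family is zero exactly when all its components over \<open>I\<close> are,
  which turns the kernel into an intersection. The factor \<open>carrier A\<close> gives the right
  value for empty \<open>I\<close>: the product then has one element and the kernel is all of
  \<open>A\<close>, whereas the bare intersection would be the whole type.\<close>

theorem theorem6p4:
  fixes A :: "('a, 'm) al_struct_scheme"
    and I :: "'i set"
    and B :: "'i \<Rightarrow> ('b, 'n) al_struct_scheme"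
    and \<alpha> :: "'i \<Rightarrow> 'a \<Rightarrow> 'b"
  assumes "al_monoid A"
    and "\<And>i. i \<in> I \<Longrightarrow> al_monoid (B i)"
    and "\<And>i. i \<in> I \<Longrightarrow> \<alpha> i \<in> al_hom A (B i)"
  shows "(\<lambda>a. \<lambda>i\<in>I. \<alpha> i a) \<in> al_hom A (al_prod I B) \<and>
    al_kernel A (al_prod I B) (\<lambda>a. \<lambda>i\<in>I. \<alpha> i a) =
      carrier A \<inter> (\<Inter>i\<in>I. al_kernel A (B i) (\<alpha> i))"
proof
  have hom: "\<alpha> i x \<in> carrier (B i)"
      "\<alpha> i (x \<oplus>\<^bsub>A\<^esub> y) = \<alpha> i x \<oplus>\<^bsub>B i\<^esub> \<alpha> i y"
      "\<alpha> i (x \<star>\<^bsub>A\<^esub> y) = \<alpha> i x \<star>\<^bsub>B i\<^esub> \<alpha> i y"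
      "\<alpha> i (x \<curlyvee>\<^bsub>A\<^esub> y) = \<alpha> i x \<curlyvee>\<^bsub>B i\<^esub> \<alpha> i y"
      "\<alpha> i (x \<curlywedge>\<^bsub>A\<^esub> y) = \<alpha> i x \<curlywedge>\<^bsub>B i\<^esub> \<alpha> i y"
      "\<alpha> i \<zero>\<^bsub>A\<^esub> = \<zero>\<^bsub>B i\<^esub>"
    if "i \<in> I" "x \<in> carrier A" "y \<in> carrier A" for i x y
    using assms(3)[OF that(1)] that(2,3) by (auto simp: al_hom_def)
  \<comment> \<open>The law for zero, \<open>hom(6)\<close>, carries premises on \<open>x\<close>
    and \<open>y\<close> that its conclusion does not mention; zero itself serves as the witness for
    both.\<close>
  have zero: "\<zero>\<^bsub>A\<^esub> \<in> carrier A"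
    using assms(1) by (rule al_monoid.zero_closed)
  show "(\<lambda>a. \<lambda>i\<in>I. \<alpha> i a) \<in> al_hom A (al_prod I B)"
    unfolding al_hom_def al_prod_def
    by (auto simp: hom hom(6)[OF _ zero zero] intro!: restrict_ext)
  \<comment> \<open>Both families are \<open>undefined\<close> off \<open>I\<close>, so only the
    indices in \<open>I\<close> can tell them apart.\<close>
  have "(\<lambda>i\<in>I. \<alpha> i a) = \<zero>\<^bsub>al_prod I B\<^esub> \<longleftrightarrow> (\<forall>i\<in>I. \<alpha> i a = \<zero>\<^bsub>B i\<^esub>)" for a
    by (auto simp: al_prod_def fun_eq_iff restrict_def)
  then show "al_kernel A (al_prod I B) (\<lambda>a. \<lambda>i\<in>I. \<alpha> i a) =
      carrier A \<inter> (\<Inter>i\<in>I. al_kernel A (B i) (\<alpha> i))"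
    by (auto simp: al_kernel_def)
qed

end
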